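(* Let $m\ge 1$ be an integer, $\lambda,\mu_1,\dots,\mu_m\in\mathbb{C}$, $h>0$ and $\theta\in\mathbb{R}$ with $1-\theta h\lambda\neq 0$. The zero solution of the stochastic difference equation given by the $\theta$-Maruyama method applied to the scalar linear test equation, $$X_{i+1}=X_i+h\big(\theta\lambda X_{i+1}+(1-\theta)\lambda X_i\big)+\sqrt{h}\sum_{r=1}^m\mu_r X_i\,\xi_{r,i},\qquad i=0,1,\dots,$$ is asymptotically mean-square stable if and only if $$\mathrm{Re}(\lambda)+\frac12\sum_{r=1}^m|\mu_r|^2+\frac12 h(1-2\theta)|\lambda|^2<0.$$
   Context: The test equation is the scalar Itô SDE $dX(t)=\lambda X(t)\,dt+\sum_{r=1}^m\mu_rX(t)\,dW_r(t)$, where $W_1,\dots,W_m$ are independent standard real Wiener processes. The $\xi_{r,i}$ ($r=1,\dots,m$, $i=0,1,\dots$) are mutually independent standard Gaussian $\mathcal N(0,1)$ real random variables. The initial value $X_0\in\mathbb{C}$ is non-random, and $X_i(X_0)$ denotes the solution of the difference equation started at $X_0$ (unique since $1-\theta h\lambda\ne0$). The zero solution ($X_i\equiv 0$) is mean-square stable if for each $\epsilon>0$ there is $\delta>0$ such that $\mathbb{E}|X_i(X_0)|^2<\epsilon$ for all $i\ge0$ whenever $|X_0|<\delta$; it is asymptotically mean-square stable if it is mean-square stable and there is $\delta>0$ such that $\mathbb{E}|X_i(X_0)|^2\to0$ as $i\to\infty$ whenever $|X_0|<\delta$. *)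

theory Defs
  imports "HOL-Probability.Probability"
begin

text \<open>The array \<open>\<xi> r i\<close>, \<open>1 \<le> r \<le> m\<close>, \<open>i \<ge> 0\<close>, consists of mutually independent real
  \<open>N(0,1)\<close> variables.  Independence is joint over all index pairs \<open>(r, i)\<close>.\<close>

definition iid_std_gaussian_noise ::
  "'w measure \<Rightarrow> nat \<Rightarrow> (nat \<Rightarrow> nat \<Rightarrow> 'w \<Rightarrow> real) \<Rightarrow> bool" where
  "iid_std_gaussian_noise M m \<xi> \<longleftrightarrow>
     prob_space.indep_vars M (\<lambda>_. borel) (\<lambda>(r, i). \<xi> r i) ({1..m} \<times> UNIV) \<and>
     (\<forall>r\<in>{1..m}. \<forall>i. distributed M lborel (\<xi> r i) std_normal_density)"

text \<open>\<open>X\<close> solves, for every outcome, the implicit \<open>\<theta>\<close>-Maruyama recursion with step size \<open>h\<close>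
  for \<open>dX = l X dt + (\<Sum>r=1..m. \<mu> r X dW r)\<close> with the non-random initial value \<open>x0\<close>;
  the complex number \<open>l\<close> is the drift coefficient, usually written as a lambda.\<close>

definition theta_maruyama_solution ::
  "'w measure \<Rightarrow> nat \<Rightarrow> real \<Rightarrow> real \<Rightarrow> complex \<Rightarrow> (nat \<Rightarrow> complex) \<Rightarrow>
     (nat \<Rightarrow> nat \<Rightarrow> 'w \<Rightarrow> real) \<Rightarrow> complex \<Rightarrow> (nat \<Rightarrow> 'w \<Rightarrow> complex) \<Rightarrow> bool" where
  "theta_maruyama_solution M m h \<theta> l \<mu> \<xi> x0 X \<longleftrightarrow>
     (\<forall>\<omega>\<in>space M.
        X 0 \<omega> = x0 \<and>
        (\<forall>i. X (Suc i) \<omega> =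
           X i \<omega>
           + of_real h * (of_real \<theta> * l * X (Suc i) \<omega> + (1 - of_real \<theta>) * l * X i \<omega>)
           + of_real (sqrt h) * (\<Sum>r=1..m. \<mu> r * X i \<omega> * of_real (\<xi> r i \<omega>))))"

lemma theta_maruyama_solution_exists:
  assumes "1 - of_real \<theta> * of_real h * l \<noteq> 0"
  shows "\<exists>X. theta_maruyama_solution M m h \<theta> l \<mu> \<xi> x0 X"
proof -
  define c where "c = 1 - of_real \<theta> * of_real h * l"
  define X where "X = (\<lambda>i \<omega>. rec_nat x0 (\<lambda>i x.
     (x + of_real h * ((1 - of_real \<theta>) * l * x)
        + of_real (sqrt h) * (\<Sum>r=1..m. \<mu> r * x * of_real (\<xi> r i \<omega>))) / c) i)"
  have "c \<noteq> 0" using assms by (simp add: c_def)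
  have impl: "y = x + of_real h * (of_real \<theta> * l * y + (1 - of_real \<theta>) * l * x) + s"
    if "y = (x + of_real h * ((1 - of_real \<theta>) * l * x) + s) / c" for x y s
  proof -
    have "y * c = x + of_real h * ((1 - of_real \<theta>) * l * x) + s"
      using that \<open>c \<noteq> 0\<close> by simp
    then show ?thesis by (simp add: c_def algebra_simps)
  qed
  have "X (Suc i) \<omega> =
      (X i \<omega> + of_real h * ((1 - of_real \<theta>) * l * X i \<omega>)
        + of_real (sqrt h) * (\<Sum>r=1..m. \<mu> r * X i \<omega> * of_real (\<xi> r i \<omega>))) / c" for i \<omega>
    unfolding X_def by (simp only: old.nat.simps)
  note impl[OF this]
  moreover have "X 0 \<omega> = x0" for \<omega>
    by (simp add: X_def)
  ultimately show ?thesis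
    unfolding theta_maruyama_solution_def by blast
qed

lemma theta_maruyama_solution_unique:
  assumes "1 - of_real \<theta> * of_real h * l \<noteq> 0"
    and X: "theta_maruyama_solution M m h \<theta> l \<mu> \<xi> x0 X"
    and Y: "theta_maruyama_solution M m h \<theta> l \<mu> \<xi> x0 Y"
    and \<omega>: "\<omega> \<in> space M"
  shows "X i \<omega> = Y i \<omega>"
proof (induction i)
  case 0
  show ?case
    using X[unfolded theta_maruyama_solution_def, THEN bspec, OF \<omega>, THEN conjunct1]
      Y[unfolded theta_maruyama_solution_def, THEN bspec, OF \<omega>, THEN conjunct1]
    by (rule trans[OF _ sym])
next
  case (Suc i)
  define x s where "x = Y i \<omega>"
    and "s = of_real (sqrt h) * (\<Sum>r=1..m. \<mu> r * x * of_real (\<xi> r i \<omega>))"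
  have 1: "X (Suc i) \<omega> =
      x + of_real h * (of_real \<theta> * l * X (Suc i) \<omega> + (1 - of_real \<theta>) * l * x) + s"
    using X[unfolded theta_maruyama_solution_def, THEN bspec, OF \<omega>, THEN conjunct2,
      rule_format, of i]
    unfolding Suc x_def s_def .
  have 2: "Y (Suc i) \<omega> =
      x + of_real h * (of_real \<theta> * l * Y (Suc i) \<omega> + (1 - of_real \<theta>) * l * x) + s"
    using Y[unfolded theta_maruyama_solution_def, THEN bspec, OF \<omega>, THEN conjunct2,
      rule_format, of i]
    unfolding x_def s_def .
  have "(1 - of_real \<theta> * of_real h * l) * (X (Suc i) \<omega> - Y (Suc i) \<omega>) = 0"
    using arg_cong2[OF 1 2, of "(-)"] by (simp add: algebra_simps)
  with assms(1) show ?case by simp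
qed

text \<open>The second moment is taken as an extended nonnegative integral, so that it is \<open>\<infinity>\<close>
  (rather than \<open>0\<close>) where the integral diverges.\<close>

definition second_moment :: "'w measure \<Rightarrow> ('w \<Rightarrow> complex) \<Rightarrow> ennreal" where
  "second_moment M Z = (\<integral>\<^sup>+\<omega>. ennreal ((cmod (Z \<omega>))\<^sup>2) \<partial>M)"

text \<open>In the following, \<open>X x0\<close> is the solution started at \<open>x0\<close>; stability refers to the
  zero solution \<open>X 0\<close>.\<close>

definition mean_square_stable ::
  "'w measure \<Rightarrow> (complex \<Rightarrow> nat \<Rightarrow> 'w \<Rightarrow> complex) \<Rightarrow> bool" where
  "mean_square_stable M X \<longleftrightarrow>
     (\<forall>\<epsilon>>0. \<exists>\<delta>>0. \<forall>x0. cmod x0 < \<delta> \<longrightarrow>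
        (\<forall>i. second_moment M (X x0 i) < ennreal \<epsilon>))"

definition asymptotically_mean_square_stable ::
  "'w measure \<Rightarrow> (complex \<Rightarrow> nat \<Rightarrow> 'w \<Rightarrow> complex) \<Rightarrow> bool" where
  "asymptotically_mean_square_stable M X \<longleftrightarrow>
     mean_square_stable M X \<and>
     (\<exists>\<delta>>0. \<forall>x0. cmod x0 < \<delta> \<longrightarrow>
        (\<lambda>i. second_moment M (X x0 i)) \<longlonglongrightarrow> 0)"

end

theory Submission
  imports Defs
begin

text \<open>Solving the implicit recursion for \<open>X (Suc i)\<close> gives \<open>X (Suc i) = X i * Z i\<close>, where the
  growth factors \<open>Z i\<close> are independent and affine in the noise of step \<open>i\<close>.  Hence
  \<open>E |X i|\<^sup>2 = |x0|\<^sup>2 * q ^ i\<close> with \<open>q = E |Z i|\<^sup>2\<close>, stability means \<open>q < 1\<close>, and this inequality is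
  the stated one multiplied by \<open>2 * h / |1 - \<theta> * h * l|\<^sup>2\<close>.\<close>

text \<open>For \<open>j \<noteq> k\<close> independence turns the expectation of the product into a
  product of vanishing means; on the diagonal it is the variance of a standard normal variable.
  \<open>has_bochner_integral\<close> carries integrability along with the value, so linear
  combinations can be integrated term by term.\<close>

lemma (in prob_space) std_normal_indep_moments:
  fixes \<xi> :: "'i \<Rightarrow> 'a \<Rightarrow> real"
  assumes indep: "indep_vars (\<lambda>_. borel) \<xi> K"
    and D: "\<And>k. k \<in> K \<Longrightarrow> distributed M lborel (\<xi> k) std_normal_density"
  shows "k \<in> K \<Longrightarrow> has_bochner_integral M (\<xi> k) 0"
    and "\<lbrakk>j \<in> K; k \<in> K\<rbrakk> \<Longrightarrow> has_bochner_integral M (\<lambda>\<omega>. \<xi> j \<omega> * \<xi> k \<omega>) (if j = k then 1 else 0)"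
proof -
  have first: "has_bochner_integral M (\<xi> k) 0" if "k \<in> K" for k
    using distributed_integrable[OF D[OF that], of "\<lambda>x. x"] integrable_std_normal_moment[of 1]
      standard_normal_distributed_expectation[OF D[OF that]]
    by (simp add: has_bochner_integral_iff)
  then show "k \<in> K \<Longrightarrow> has_bochner_integral M (\<xi> k) 0" .
  assume jk: "j \<in> K" "k \<in> K"
  show "has_bochner_integral M (\<lambda>\<omega>. \<xi> j \<omega> * \<xi> k \<omega>) (if j = k then 1 else 0)"
  proof (cases "j = k")
    case True
    have "integrable M (\<lambda>\<omega>. (\<xi> k \<omega>)\<^sup>2)"
      using distributed_integrable[OF D[OF jk(2)], of "\<lambda>x. x\<^sup>2"] integrable_std_normal_moment[of 2]
      by simp
    moreover have "expectation (\<lambda>\<omega>. (\<xi> k \<omega>)\<^sup>2) = 1"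
      using standard_normal_distributed_variance[OF D[OF jk(2)]]
        standard_normal_distributed_expectation[OF D[OF jk(2)]] by simp
    ultimately show ?thesis
      using True by (simp add: has_bochner_integral_iff power2_eq_square)
  next
    case False
    \<comment> \<open>The product of two variables is treated as a product over the index set
      \<open>{j, k}\<close>; since \<open>j \<noteq> k\<close>, it has exactly two factors.\<close>
    have ind: "indep_vars (\<lambda>_. borel) \<xi> {j, k}"
      using indep by (rule indep_vars_subset) (use jk in auto)
    have int: "integrable M (\<xi> i)" if "i \<in> {j, k}" for i
      using first that jk by (auto simp: has_bochner_integral_iff)
    have "integrable M (\<lambda>\<omega>. \<Prod>i\<in>{j, k}. \<xi> i \<omega>)"
      by (rule indep_vars_integrable[OF _ ind int]) auto
    moreover have "expectation (\<lambda>\<omega>. \<Prod>i\<in>{j, k}. \<xi> i \<omega>) = (\<Prod>i\<in>{j, k}. expectation (\<xi> i))"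
      by (rule indep_vars_lebesgue_integral[OF _ ind int]) auto
    ultimately show ?thesis
      using False first[OF jk(1)] by (simp add: has_bochner_integral_iff)
  qed
qed

text \<open>Uncorrelatedness suffices: in the expanded square the linear term has mean zero, and
  only the diagonal of the double sum survives.\<close>

lemma (in prob_space) has_bochner_integral_square_affine:
  fixes \<xi> :: "'i \<Rightarrow> 'a \<Rightarrow> real" and c :: "'i \<Rightarrow> real"
  assumes "finite K"
    and mean: "\<And>k. k \<in> K \<Longrightarrow> has_bochner_integral M (\<xi> k) 0"
    and cov: "\<And>j k. j \<in> K \<Longrightarrow> k \<in> K \<Longrightarrow>
      has_bochner_integral M (\<lambda>\<omega>. \<xi> j \<omega> * \<xi> k \<omega>) (if j = k then 1 else 0)"
  shows "has_bochner_integral M (\<lambda>\<omega>. (u + (\<Sum>k\<in>K. c k * \<xi> k \<omega>))\<^sup>2) (u\<^sup>2 + (\<Sum>k\<in>K. (c k)\<^sup>2))"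
proof -
  have const: "has_bochner_integral M (\<lambda>\<omega>. u\<^sup>2) (u\<^sup>2)"
    by (simp add: has_bochner_integral_iff prob_space)
  \<comment> \<open>The integrand is written in expanded form so that the linearity rules produce
    its integral; the two equations below fold integrand and value back.\<close>
  have "has_bochner_integral M
      (\<lambda>\<omega>. u\<^sup>2 + 2 * u * (\<Sum>k\<in>K. c k * \<xi> k \<omega>) + (\<Sum>j\<in>K. \<Sum>k\<in>K. c j * c k * (\<xi> j \<omega> * \<xi> k \<omega>)))
      (u\<^sup>2 + 2 * u * (\<Sum>k\<in>K. c k * 0) + (\<Sum>j\<in>K. \<Sum>k\<in>K. c j * c k * (if j = k then 1 else 0)))"
    by (intro has_bochner_integral_add has_bochner_integral_sum has_bochner_integral_mult_right
        const mean cov)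
  also have "(\<lambda>\<omega>. u\<^sup>2 + 2 * u * (\<Sum>k\<in>K. c k * \<xi> k \<omega>)
        + (\<Sum>j\<in>K. \<Sum>k\<in>K. c j * c k * (\<xi> j \<omega> * \<xi> k \<omega>)))
      = (\<lambda>\<omega>. (u + (\<Sum>k\<in>K. c k * \<xi> k \<omega>))\<^sup>2)"
    by (simp add: power2_sum power2_eq_square[of "sum _ _"] sum_product mult_ac add_ac)
  also have "u\<^sup>2 + 2 * u * (\<Sum>k\<in>K. c k * 0) + (\<Sum>j\<in>K. \<Sum>k\<in>K. c j * c k * (if j = k then 1 else 0))
      = u\<^sup>2 + (\<Sum>k\<in>K. (c k)\<^sup>2)"
    using \<open>finite K\<close> by (simp add: power2_eq_square if_distrib cong: if_cong)
  finally show ?thesis .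
qed

text \<open>The noise is real, so the real and imaginary parts of the affine form are real affine
  forms in the same noise. Their squares are integrated separately and added; no independence
  between the two parts is involved.\<close>

lemma (in prob_space) second_moment_affine_std_normal:
  fixes \<xi> :: "'i \<Rightarrow> 'a \<Rightarrow> real" and a :: complex and b :: "'i \<Rightarrow> complex"
  assumes "finite K" "indep_vars (\<lambda>_. borel) \<xi> K"
    and "\<And>k. k \<in> K \<Longrightarrow> distributed M lborel (\<xi> k) std_normal_density"
  shows "second_moment M (\<lambda>\<omega>. a + (\<Sum>k\<in>K. b k * of_real (\<xi> k \<omega>)))
    = ennreal ((cmod a)\<^sup>2 + (\<Sum>k\<in>K. (cmod (b k))\<^sup>2))"
proof -
  note sq = has_bochner_integral_square_affine[OF assms(1) std_normal_indep_moments[OF assms(2,3)]]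
  have "has_bochner_integral M
      (\<lambda>\<omega>. (Re a + (\<Sum>k\<in>K. Re (b k) * \<xi> k \<omega>))\<^sup>2 + (Im a + (\<Sum>k\<in>K. Im (b k) * \<xi> k \<omega>))\<^sup>2)
      (((Re a)\<^sup>2 + (\<Sum>k\<in>K. (Re (b k))\<^sup>2)) + ((Im a)\<^sup>2 + (\<Sum>k\<in>K. (Im (b k))\<^sup>2)))"
    by (intro has_bochner_integral_add sq)
  also have "((Re a)\<^sup>2 + (\<Sum>k\<in>K. (Re (b k))\<^sup>2)) + ((Im a)\<^sup>2 + (\<Sum>k\<in>K. (Im (b k))\<^sup>2))
      = (cmod a)\<^sup>2 + (\<Sum>k\<in>K. (cmod (b k))\<^sup>2)"
    by (simp add: cmod_power2 sum.distrib)
  also have "(\<lambda>\<omega>. (Re a + (\<Sum>k\<in>K. Re (b k) * \<xi> k \<omega>))\<^sup>2 + (Im a + (\<Sum>k\<in>K. Im (b k) * \<xi> k \<omega>))\<^sup>2)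
      = (\<lambda>\<omega>. (cmod (a + (\<Sum>k\<in>K. b k * of_real (\<xi> k \<omega>))))\<^sup>2)"
    by (simp add: cmod_power2)
  finally show ?thesis
    unfolding second_moment_def
    \<comment> \<open>The integrand is nonnegative and integrable, so its extended integral is the
      Bochner integral just computed.\<close>
    by (subst nn_integral_eq_integral) (auto simp: has_bochner_integral_iff)
qed

text \<open>The columns \<open>R \<times> {i}\<close> are disjoint for distinct \<open>i\<close>.
  Grouping the jointly independent noise by columns gives independent random vectors, and each
  growth factor is a measurable function of its own column.\<close>

lemma (in prob_space) indep_vars_affine_steps:
  fixes \<xi> :: "nat \<Rightarrow> nat \<Rightarrow> 'a \<Rightarrow> real"
  assumes "indep_vars (\<lambda>_. borel) (\<lambda>(r, i). \<xi> r i) (R \<times> UNIV)"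
  shows "indep_vars (\<lambda>_. borel) (\<lambda>i \<omega>. a + (\<Sum>r\<in>R. b r * complex_of_real (\<xi> r i \<omega>))) I"
proof -
  have "indep_vars (\<lambda>i. PiM (R \<times> {i}) (\<lambda>_. borel))
      (\<lambda>i \<omega>. restrict (\<lambda>p. (case p of (r, i) \<Rightarrow> \<xi> r i) \<omega>) (R \<times> {i})) I"
    by (rule indep_vars_restrict[OF assms]) (auto simp: disjoint_family_on_def)
  then have "indep_vars (\<lambda>_. borel)
      (\<lambda>i \<omega>. a + (\<Sum>r\<in>R. b r * complex_of_real
        (restrict (\<lambda>p. (case p of (r, i) \<Rightarrow> \<xi> r i) \<omega>) (R \<times> {i}) (r, i)))) I"
    by (rule indep_vars_compose2) measurable
  then show ?thesis
    by simp
qed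

text \<open>The squared modulus is multiplicative and inherits independence from \<open>Z\<close>.
  Working with extended nonnegative integrals, the expectation factors without any integrability
  condition.\<close>

lemma (in prob_space) second_moment_prod:
  fixes Z :: "nat \<Rightarrow> 'a \<Rightarrow> complex"
  assumes "indep_vars (\<lambda>_. borel) Z {..<n}"
  shows "second_moment M (\<lambda>\<omega>. x * (\<Prod>i<n. Z i \<omega>))
    = ennreal ((cmod x)\<^sup>2) * (\<Prod>i<n. second_moment M (Z i))"
proof -
  have ind: "indep_vars (\<lambda>_. borel) (\<lambda>i \<omega>. ennreal ((cmod (Z i \<omega>))\<^sup>2)) {..<n}"
    using assms by (rule indep_vars_compose2) measurable
  have [measurable]: "Z i \<in> borel_measurable M" if "i \<in> {..<n}" for i
    using assms that by (auto simp: indep_vars_def)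
  have "second_moment M (\<lambda>\<omega>. x * (\<Prod>i<n. Z i \<omega>))
      = (\<integral>\<^sup>+\<omega>. ennreal ((cmod x)\<^sup>2) * (\<Prod>i<n. ennreal ((cmod (Z i \<omega>))\<^sup>2)) \<partial>M)"
    by (simp add: second_moment_def norm_mult prod_norm[symmetric] power_mult_distrib
        ennreal_mult prod_ennreal prod_power_distrib prod_nonneg)
  also have "\<dots> = ennreal ((cmod x)\<^sup>2) * (\<Prod>i<n. second_moment M (Z i))"
    unfolding second_moment_def
    by (subst nn_integral_cmult) (auto simp: indep_vars_nn_integral[OF _ ind])
  finally show ?thesis .
qed

text \<open>Drift and noise are both linear in the state, so each step multiplies it by a factor
  depending only on the noise of that step. The identity is pathwise and involves no
  probability.\<close>

lemma theta_maruyama_solution_prod: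
  assumes c: "1 - of_real \<theta> * of_real h * l \<noteq> 0"
    and X: "theta_maruyama_solution M m h \<theta> l \<mu> \<xi> x0 X"
    and \<omega>: "\<omega> \<in> space M"
  defines "c \<equiv> 1 - of_real \<theta> * of_real h * l"
  shows "X n \<omega> = x0 * (\<Prod>i<n. (1 + of_real h * (1 - of_real \<theta>) * l) / c
    + (\<Sum>r=1..m. of_real (sqrt h) * \<mu> r / c * of_real (\<xi> r i \<omega>)))"
proof (induction n)
  case 0
  show ?case
    using X \<omega> by (simp add: theta_maruyama_solution_def)
next
  case (Suc n)
  let ?x = "X n \<omega>" and ?s = "\<Sum>r=1..m. \<mu> r * of_real (\<xi> r n \<omega>)"
  have "X (Suc n) \<omega> = ?x
      + of_real h * (of_real \<theta> * l * X (Suc n) \<omega> + (1 - of_real \<theta>) * l * ?x)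
      + of_real (sqrt h) * (\<Sum>r=1..m. \<mu> r * ?x * of_real (\<xi> r n \<omega>))"
    using X \<omega> unfolding theta_maruyama_solution_def by blast
  also have "(\<Sum>r=1..m. \<mu> r * ?x * of_real (\<xi> r n \<omega>)) = ?x * ?s"
    by (simp add: sum_distrib_left mult_ac)
  \<comment> \<open>Moving the implicit drift term to the left collects the factor \<open>c\<close>;
    as \<open>c\<close> is nonzero, it can then be divided out.\<close>
  finally have step: "c * X (Suc n) \<omega>
      = ?x * (1 + of_real h * (1 - of_real \<theta>) * l + of_real (sqrt h) * ?s)"
    unfolding c_def by algebra
  have "X (Suc n) \<omega> = c * X (Suc n) \<omega> / c"
    using c by (simp add: c_def)
  then have "X (Suc n) \<omega>
      = ?x * ((1 + of_real h * (1 - of_real \<theta>) * l) / c + of_real (sqrt h) / c * ?s)"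
    unfolding step by (simp add: add_divide_distrib distrib_left)
  then show ?case
    by (simp add: Suc.IH sum_distrib_left mult_ac)
qed

lemma asymptotically_mean_square_stable_geometric:
  fixes q :: real
  assumes "q \<ge> 0" and mom: "\<And>x0 n. second_moment M (X x0 n) = ennreal ((cmod x0)\<^sup>2 * q ^ n)"
  shows "asymptotically_mean_square_stable M X \<longleftrightarrow> q < 1"
proof
  assume "asymptotically_mean_square_stable M X"
  then obtain \<delta> where "\<delta> > 0"
    and \<delta>: "\<And>x0. cmod x0 < \<delta> \<Longrightarrow> (\<lambda>n. second_moment M (X x0 n)) \<longlonglongrightarrow> 0"
    unfolding asymptotically_mean_square_stable_def by blast
  have "(\<lambda>n. ennreal ((\<delta> / 2)\<^sup>2 * q ^ n)) \<longlonglongrightarrow> ennreal 0"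
    \<comment> \<open>The initial value \<open>\<delta> / 2\<close> lies within the radius of
      attraction and is nonzero, so its square can be cancelled from the limit.\<close>
    using \<delta>[of "of_real (\<delta> / 2)"] \<open>\<delta> > 0\<close> unfolding mom by simp
  then have "(\<lambda>n. (\<delta> / 2)\<^sup>2 * q ^ n) \<longlonglongrightarrow> 0"
    using \<open>q \<ge> 0\<close> by (subst (asm) tendsto_ennreal_iff) auto
  then have lim: "(\<lambda>n. q ^ n) \<longlonglongrightarrow> 0"
    using \<open>\<delta> > 0\<close> by (simp add: tendsto_mult_left_iff[where l = 0, simplified])
  show "q < 1"
  proof (rule ccontr)
    assume "\<not> q < 1"
    then have "1 \<le> q ^ n" for n
      by (simp add: one_le_power)
    with lim have "(1::real) \<le> 0"
      by (meson LIMSEQ_le_const)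
    then show False
      by simp
  qed
next
  assume "q < 1"
  have "mean_square_stable M X"
    unfolding mean_square_stable_def
  proof (intro allI impI)
    fix \<epsilon> :: real
    assume "\<epsilon> > 0"
    \<comment> \<open>Since \<open>q ^ n \<le> 1\<close>, the second moment never exceeds its
      initial value, which makes \<open>sqrt \<epsilon>\<close> a suitable radius.\<close>
    have "second_moment M (X x0 n) < ennreal \<epsilon>" if "cmod x0 < sqrt \<epsilon>" for x0 n
    proof -
      have "(cmod x0)\<^sup>2 * q ^ n \<le> (cmod x0)\<^sup>2"
        using \<open>q \<ge> 0\<close> \<open>q < 1\<close> by (simp add: mult_left_le power_le_one)
      also have "\<dots> < \<epsilon>"
        using that \<open>\<epsilon> > 0\<close> power_strict_mono[of "cmod x0" "sqrt \<epsilon>" 2] by simp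
      finally show ?thesis
        using \<open>\<epsilon> > 0\<close> by (simp add: mom ennreal_lessI)
    qed
    then show "\<exists>\<delta>>0. \<forall>x0. cmod x0 < \<delta> \<longrightarrow> (\<forall>i. second_moment M (X x0 i) < ennreal \<epsilon>)"
      using \<open>\<epsilon> > 0\<close> by (intro exI[of _ "sqrt \<epsilon>"]) auto
  qed
  \<comment> \<open>Attraction is global, so any positive radius serves in the definition; the
    conclusion below takes 1.\<close>
  moreover have "(\<lambda>n. second_moment M (X x0 n)) \<longlonglongrightarrow> 0" for x0
  proof -
    have "(\<lambda>n. (cmod x0)\<^sup>2 * q ^ n) \<longlonglongrightarrow> 0"
      using \<open>q \<ge> 0\<close> \<open>q < 1\<close> by (intro tendsto_mult_right_zero LIMSEQ_power_zero) simp
    then show ?thesis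
      unfolding mom using tendsto_ennrealI by fastforce
  qed
  ultimately show "asymptotically_mean_square_stable M X"
    unfolding asymptotically_mean_square_stable_def using zero_less_one by blast
qed

lemma growth_factor_less_one_iff:
  fixes h \<theta> :: real and l :: complex
  assumes "h > 0" and c: "1 - of_real \<theta> * of_real h * l \<noteq> 0"
  defines "c \<equiv> 1 - of_real \<theta> * of_real h * l"
  shows "(cmod ((1 + of_real h * (1 - of_real \<theta>) * l) / c))\<^sup>2
      + (\<Sum>r\<in>R. (cmod (of_real (sqrt h) * \<mu> r / c))\<^sup>2) < 1 \<longleftrightarrow>
    Re l + 1 / 2 * (\<Sum>r\<in>R. (cmod (\<mu> r))\<^sup>2) + 1 / 2 * h * (1 - 2 * \<theta>) * (cmod l)\<^sup>2 < 0"
    (is "?q < 1 \<longleftrightarrow> ?k < 0")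
proof -
  have pos: "(cmod c)\<^sup>2 > 0"
    using c by (simp add: c_def)
  have "?q = ((cmod (1 + of_real h * (1 - of_real \<theta>) * l))\<^sup>2 + h * (\<Sum>r\<in>R. (cmod (\<mu> r))\<^sup>2))
      / (cmod c)\<^sup>2"
    using \<open>h > 0\<close>
    by (simp add: norm_divide norm_mult power_divide power_mult_distrib sum_distrib_left
        flip: sum_divide_distrib add_divide_distrib)
  \<comment> \<open>In the difference of the two squared moduli the terms quadratic in
    \<open>\<theta>\<close> cancel, because
    \<open>(1 - \<theta>)\<^sup>2 - \<theta>\<^sup>2 = 1 - 2 * \<theta>\<close>. This leaves a
    multiple of \<open>2 * h\<close>.\<close>
  also have "(cmod (1 + of_real h * (1 - of_real \<theta>) * l))\<^sup>2
      = (cmod c)\<^sup>2 + 2 * h * (Re l + 1 / 2 * h * (1 - 2 * \<theta>) * (cmod l)\<^sup>2)"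
    unfolding c_def cmod_power2 by (simp add: power2_eq_square algebra_simps)
  finally have "?q = 1 + 2 * h / (cmod c)\<^sup>2 * ?k"
    using pos by (simp add: field_simps)
  then show ?thesis
    using pos \<open>h > 0\<close> by (simp add: divide_less_0_iff mult_less_0_iff)
qed

theorem corollary3p2:
  fixes M :: "'w measure"
    and m :: nat
    and h \<theta> :: real
    and l :: complex
    and \<mu> :: "nat \<Rightarrow> complex"
    and \<xi> :: "nat \<Rightarrow> nat \<Rightarrow> 'w \<Rightarrow> real"
    and X :: "complex \<Rightarrow> nat \<Rightarrow> 'w \<Rightarrow> complex"
  assumes "prob_space M"
    and "m \<ge> 1"
    and "h > 0"
    and "1 - of_real \<theta> * of_real h * l \<noteq> 0"
    and "iid_std_gaussian_noise M m \<xi>"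
    and "\<And>x0. theta_maruyama_solution M m h \<theta> l \<mu> \<xi> x0 (X x0)"
  shows "asymptotically_mean_square_stable M X \<longleftrightarrow>
    Re l + 1 / 2 * (\<Sum>r=1..m. (cmod (\<mu> r))\<^sup>2) + 1 / 2 * h * (1 - 2 * \<theta>) * (cmod l)\<^sup>2 < 0"
proof -
  interpret prob_space M by fact
  define c where "c = 1 - of_real \<theta> * of_real h * l"
  define a where "a = (1 + of_real h * (1 - of_real \<theta>) * l) / c"
  define b where "b = (\<lambda>r. of_real (sqrt h) * \<mu> r / c)"
  define Z where "Z = (\<lambda>i \<omega>. a + (\<Sum>r=1..m. b r * of_real (\<xi> r i \<omega>)))"
  define q where "q = (cmod a)\<^sup>2 + (\<Sum>r=1..m. (cmod (b r))\<^sup>2)"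
  have q: "q \<ge> 0"
    by (simp add: q_def sum_nonneg)
  have indep: "indep_vars (\<lambda>_. borel) (\<lambda>(r, i). \<xi> r i) ({1..m} \<times> UNIV)"
    and D: "\<And>r i. r \<in> {1..m} \<Longrightarrow> distributed M lborel (\<xi> r i) std_normal_density"
    using assms(5) by (auto simp: iid_std_gaussian_noise_def)
  have "second_moment M (Z i) = ennreal q" for i
  proof -
    \<comment> \<open>The moment formula is applied to the single column
      \<open>{1..m} \<times> {i}\<close> of the pair-indexed family; sums over this column reduce to
      sums over \<open>r\<close>.\<close>
    have "indep_vars (\<lambda>_. borel) (\<lambda>(r, i). \<xi> r i) ({1..m} \<times> {i})"
      using indep by (rule indep_vars_subset) auto
    then have "second_moment M (\<lambda>\<omega>. a + (\<Sum>p\<in>{1..m} \<times> {i}. b (fst p)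
          * of_real ((case p of (r, i) \<Rightarrow> \<xi> r i) \<omega>)))
        = ennreal ((cmod a)\<^sup>2 + (\<Sum>p\<in>{1..m} \<times> {i}. (cmod (b (fst p)))\<^sup>2))"
      by (intro second_moment_affine_std_normal) (use D in auto)
    then show ?thesis
      by (simp add: Z_def q_def sum.cartesian_product')
  qed
  moreover have "indep_vars (\<lambda>_. borel) Z {..<n}" for n
    unfolding Z_def by (rule indep_vars_affine_steps[OF indep])
  \<comment> \<open>The product formula holds at every point of \<open>space M\<close>, which is all
    that congruence of the integral requires.\<close>
  moreover have "second_moment M (X x0 n) = second_moment M (\<lambda>\<omega>. x0 * (\<Prod>i<n. Z i \<omega>))" for x0 n
    unfolding second_moment_def Z_def a_def b_def c_def
    by (intro nn_integral_cong) (simp only: theta_maruyama_solution_prod[OF assms(4,6)])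
  ultimately have "second_moment M (X x0 n) = ennreal ((cmod x0)\<^sup>2 * q ^ n)" for x0 n
    using q by (simp add: second_moment_prod ennreal_mult ennreal_power)
  then have "asymptotically_mean_square_stable M X \<longleftrightarrow> q < 1"
    by (rule asymptotically_mean_square_stable_geometric[OF q])
  then show ?thesis
    using growth_factor_less_one_iff[OF assms(3,4), of \<mu> "{1..m}"]
    by (simp add: q_def a_def b_def c_def)
qed

end
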